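(* Let $q_0$ be a relative equilibrium of the planar Newtonian $n$-body problem ($n\ge3$) for which the linearized reduced Hamiltonian splits into independent blocks on invariant symplectic planes, i.e. for which the shape coordinates $(x_1,y_1,\dots,x_{n-2},y_{n-2})$ can be chosen so that the quadratic part of the reduced effective potential is $$V_{\mathrm{lin}}=\sum_{i=1}^{n-2}\big(-\alpha_ix_i^2-\beta_iy_i^2\big)$$ with constants $\alpha_i,\beta_i\in\mathbb{R}$. If the curvature stability condition fails on one of these planes, i.e. if for some $i$ with $\alpha_i,\beta_i>0$ the inequality $$\sqrt{\alpha_i}+\sqrt{\beta_i}<\sqrt2\,k$$ does not hold, where $k$ is the angular velocity of the relative equilibrium, then the relative equilibrium is linearly unstable.
   Context: Configurations of $n$ masses $m_1,\dots,m_n>0$ in the plane are $q=(q_1,\dots,q_n)\in\mathbb{R}^{2n}$; $M=\mathrm{diag}(m_1\mathbb{I}_2,\dots,m_n\mathbb{I}_2)$, $|q|_M^2=q^\top Mq$, and $U(q)=\sum_{i<j}\frac{m_im_j}{|q_i-q_j|}$. A relative equilibrium is given by a collision-free central configuration $q_0$ with center of mass at the origin, normalized by $|q_0|_M=1$, so that $M^{-1}\nabla U(q_0)+U(q_0)q_0=0$; it rotates rigidly with angular velocity $k=\sqrt{U(q_0)}$. In coordinates rotating with angular velocity $k$ the effective potential is $V(q)=-U(q)-\tfrac12k^2|q|_M^2$ and the relative equilibrium becomes an equilibrium point. Let $J$ act on $\mathbb{R}^{2n}=(\mathbb{R}^2)^n$ by applying $\begin{pmatrix}0&-1\\1&0\end{pmatrix}$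 in each factor. Shape coordinates: let $B\in\mathbb{R}^{2n\times(2n-4)}$ be a matrix whose columns are $M$-orthonormal, come in pairs $w_i,Jw_i$ ($i=1,\dots,n-2$), and are $M$-orthogonal to the translation vectors $(1,0,1,0,\dots,1,0)$, $(0,1,0,1,\dots,0,1)$ and to $q_0$, $Jq_0$. The configuration with shape coordinates $z=(x_1,y_1,\dots,x_{n-2},y_{n-2})\in\mathbb{R}^{2n-4}$ is $q=Bz$, with $(x_i,y_i)$ the coordinates along $w_i,Jw_i$. The reduced potential is $V_{\mathrm{red}}(z)=V(Bz)$, the relative equilibrium corresponds to $z=0$, and the quadratic part of the reduced potential there is $V_{\mathrm{lin}}(z)=\tfrac12\langle D^2V_{\mathrm{red}}(0)z,z\rangle$ with $D^2V_{\mathrm{red}}(0)=-B^\top D^2U(q_0)B-k^2\mathbb{I}_{2n-4}$ (in these expressions derivatives are evaluated at $q_0$). The reduced magnetic potential is $\vartheta_{\mathrm{red}}=k\sum_{i=1}^{n-2}(y_i\,dx_i-x_i\,dy_i)$. The linearized reduced Hamiltonian on $T^*\mathbb{R}^{2n-4}$ is $$H_{\mathrm{lin}}(z,p)=\tfrac12\sum_{i=1}^{n-2}\big[(p_{x_i}-ky_i)^2+(p_{y_i}+kx_i)^2\big]+V_{\mathrm{lin}}(z).$$ The relative equilibrium is linearly stable if the matrix of the linear Hamiltonian system generated by $H_{\mathrm{lin}}$ on $T^*\mathbb{R}^{2n-4}\cong\mathbb{R}^{4n-8}$ (the linearized system restricted to the symplectic complement of the directions coming from the translational and rotational symmetries)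 has purely imaginary spectrum and is diagonalizable over $\mathbb{C}$; it is linearly unstable if it is not linearly stable. *)

theory Defs
  imports "HOL-Analysis.Derivative" "Jordan_Normal_Form.Spectral_Radius"
begin

text \<open>
  Vectors and matrices of size depending on \<open>n\<close> are those of the Jordan-normal-form library,
  indexed from 0. A configuration of \<open>n\<close> bodies is a vector of dimension \<open>2 * n\<close>, in which body
  \<open>i < n\<close> has the coordinates \<open>q $ (2 * i)\<close> and \<open>q $ (2 * i + 1)\<close>. In the same way the shape
  coordinates \<open>(x\<^sub>i, y\<^sub>i)\<close>, \<open>i < n - 2\<close>, are the entries \<open>2 * i\<close> and \<open>2 * i + 1\<close> of a vector of
  dimension \<open>2 * n - 4\<close>.
\<close>

unbundle no vec_syntax
no_notation inner (infix \<open>\<bullet>\<close> 70)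

definition partial :: "nat \<Rightarrow> (real vec \<Rightarrow> real) \<Rightarrow> real vec \<Rightarrow> real" where
  "partial i f q = deriv (\<lambda>t. f (q + t \<cdot>\<^sub>v unit_vec (dim_vec q) i)) 0"

definition gradient :: "(real vec \<Rightarrow> real) \<Rightarrow> real vec \<Rightarrow> real vec" where
  "gradient f q = vec (dim_vec q) (\<lambda>i. partial i f q)"

definition hessian :: "(real vec \<Rightarrow> real) \<Rightarrow> real vec \<Rightarrow> real mat" where
  "hessian f q = mat (dim_vec q) (dim_vec q) (\<lambda>(i, j). partial i (partial j f) q)"


definition mass_mat :: "nat \<Rightarrow> (nat \<Rightarrow> real) \<Rightarrow> real mat" where
  "mass_mat n m = mat_diag (2 * n) (\<lambda>i. m (i div 2))"

definition mass_inner :: "nat \<Rightarrow> (nat \<Rightarrow> real) \<Rightarrow> real vec \<Rightarrow> real vec \<Rightarrow> real" where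
  "mass_inner n m u v = u \<bullet> (mass_mat n m *\<^sub>v v)"

definition mass_norm :: "nat \<Rightarrow> (nat \<Rightarrow> real) \<Rightarrow> real vec \<Rightarrow> real" where
  "mass_norm n m q = sqrt (mass_inner n m q q)"

definition body_dist :: "real vec \<Rightarrow> nat \<Rightarrow> nat \<Rightarrow> real" where
  "body_dist q i j =
     sqrt ((q $ (2 * i) - q $ (2 * j))\<^sup>2 + (q $ (2 * i + 1) - q $ (2 * j + 1))\<^sup>2)"

definition collision_free :: "nat \<Rightarrow> real vec \<Rightarrow> bool" where
  "collision_free n q \<longleftrightarrow> (\<forall>j<n. \<forall>i<j. body_dist q i j \<noteq> 0)"

definition newton_U :: "nat \<Rightarrow> (nat \<Rightarrow> real) \<Rightarrow> real vec \<Rightarrow> real" where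
  "newton_U n m q = (\<Sum>j<n. \<Sum>i<j. m i * m j / body_dist q i j)"

text \<open>
  In the equation of a normalized central configuration the inverse of
  \<open>M = mass_mat n m\<close> is written as the diagonal matrix of the inverse masses.
\<close>

definition relative_equilibrium :: "nat \<Rightarrow> (nat \<Rightarrow> real) \<Rightarrow> real vec \<Rightarrow> bool" where
  "relative_equilibrium n m q0 \<longleftrightarrow>
     q0 \<in> carrier_vec (2 * n) \<and>
     collision_free n q0 \<and>
     (\<Sum>i<n. m i * q0 $ (2 * i)) = 0 \<and> (\<Sum>i<n. m i * q0 $ (2 * i + 1)) = 0 \<and>
     mass_norm n m q0 = 1 \<and>
     mass_mat n (\<lambda>i. inverse (m i)) *\<^sub>v gradient (newton_U n m) q0
       + newton_U n m q0 \<cdot>\<^sub>v q0 = 0\<^sub>v (2 * n)"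

definition ang_vel :: "nat \<Rightarrow> (nat \<Rightarrow> real) \<Rightarrow> real vec \<Rightarrow> real" where
  "ang_vel n m q0 = sqrt (newton_U n m q0)"

definition eff_pot :: "nat \<Rightarrow> (nat \<Rightarrow> real) \<Rightarrow> real vec \<Rightarrow> real vec \<Rightarrow> real" where
  "eff_pot n m q0 q = - newton_U n m q - (ang_vel n m q0)\<^sup>2 / 2 * (mass_norm n m q)\<^sup>2"


definition rotJ :: "real vec \<Rightarrow> real vec" where
  "rotJ v = vec (dim_vec v) (\<lambda>i. if even i then - v $ (i + 1) else v $ (i - 1))"

definition transl_x :: "nat \<Rightarrow> real vec" where
  "transl_x n = vec (2 * n) (\<lambda>i. if even i then 1 else 0)"

definition transl_y :: "nat \<Rightarrow> real vec" where
  "transl_y n = vec (2 * n) (\<lambda>i. if even i then 0 else 1)"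

definition shape_basis :: "nat \<Rightarrow> (nat \<Rightarrow> real) \<Rightarrow> real vec \<Rightarrow> real mat \<Rightarrow> bool" where
  "shape_basis n m q0 B \<longleftrightarrow>
     B \<in> carrier_mat (2 * n) (2 * n - 4) \<and>
     (\<forall>i < 2 * n - 4. \<forall>j < 2 * n - 4.
        mass_inner n m (col B i) (col B j) = (if i = j then 1 else 0)) \<and>
     (\<forall>i < n - 2. col B (2 * i + 1) = rotJ (col B (2 * i))) \<and>
     (\<forall>i < 2 * n - 4. \<forall>v \<in> {transl_x n, transl_y n, q0, rotJ q0}.
        mass_inner n m (col B i) v = 0)"

text \<open>
  The shape coordinates are centred at the relative equilibrium: \<open>z = 0\<close> stands for \<open>q0\<close>, so
  that the derivatives of the reduced potential at \<open>0\<close> are derivatives of the effective potential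
  at \<open>q0\<close>. The lemma \<open>hessian_V_red\<close> below gives the resulting formula for the Hessian.
\<close>

definition V_red :: "nat \<Rightarrow> (nat \<Rightarrow> real) \<Rightarrow> real vec \<Rightarrow> real mat \<Rightarrow> real vec \<Rightarrow> real" where
  "V_red n m q0 B z = eff_pot n m q0 (q0 + B *\<^sub>v z)"

definition V_lin :: "nat \<Rightarrow> (nat \<Rightarrow> real) \<Rightarrow> real vec \<Rightarrow> real mat \<Rightarrow> real vec \<Rightarrow> real" where
  "V_lin n m q0 B z = (hessian (V_red n m q0 B) (0\<^sub>v (2 * n - 4)) *\<^sub>v z) \<bullet> z / 2"

definition H_lin ::
  "nat \<Rightarrow> (nat \<Rightarrow> real) \<Rightarrow> real vec \<Rightarrow> real mat \<Rightarrow> real vec \<Rightarrow> real vec \<Rightarrow> real" where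
  "H_lin n m q0 B z p =
     (let k = ang_vel n m q0 in
       (\<Sum>i < n - 2. (p $ (2 * i) - k * z $ (2 * i + 1))\<^sup>2
                   + (p $ (2 * i + 1) + k * z $ (2 * i))\<^sup>2) / 2
       + V_lin n m q0 B z)"

text \<open>
  The matrix of the linear system \<open>z' = \<partial>H/\<partial>p\<close>, \<open>p' = - \<partial>H/\<partial>z\<close> generated by a
  quadratic Hamiltonian \<open>H\<close> with \<open>d\<close> degrees of freedom, acting on the stacked vectors \<open>(z, p)\<close>.
\<close>

definition hamiltonian_mat :: "nat \<Rightarrow> (real vec \<Rightarrow> real vec \<Rightarrow> real) \<Rightarrow> real mat" where
  "hamiltonian_mat d H =
     four_block_mat (0\<^sub>m d d) (1\<^sub>m d) (- 1\<^sub>m d) (0\<^sub>m d d)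
       * hessian (\<lambda>v. H (vec_first v d) (vec_last v d)) (0\<^sub>v (2 * d))"

definition diagonalizable_complex :: "real mat \<Rightarrow> bool" where
  "diagonalizable_complex A \<longleftrightarrow>
     (\<exists>D. diagonal_mat D \<and> similar_mat (map_mat complex_of_real A) D)"

definition linearly_stable :: "nat \<Rightarrow> (nat \<Rightarrow> real) \<Rightarrow> real vec \<Rightarrow> real mat \<Rightarrow> bool" where
  "linearly_stable n m q0 B \<longleftrightarrow>
     (let A = hamiltonian_mat (2 * n - 4) (H_lin n m q0 B) in
       (\<forall>l \<in> spectrum (map_mat complex_of_real A). Re l = 0) \<and> diagonalizable_complex A)"

definition linearly_unstable :: "nat \<Rightarrow> (nat \<Rightarrow> real) \<Rightarrow> real vec \<Rightarrow> real mat \<Rightarrow> bool" where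
  "linearly_unstable n m q0 B \<longleftrightarrow> \<not> linearly_stable n m q0 B"


text \<open>
  The rest of the theory derives \<open>D\<^sup>2 V_red(0) = - B\<^sup>T D\<^sup>2 U(q0) B - k\<^sup>2 I\<close>.
  \<open>newton_D\<close> and \<open>newton_DD\<close> are the first and second directional derivatives of \<open>U\<close> at
  a collision-free configuration.
\<close>

definition diff_x :: "real vec \<Rightarrow> nat \<Rightarrow> nat \<Rightarrow> real" where
  "diff_x q i j = q $ (2 * i) - q $ (2 * j)"

definition diff_y :: "real vec \<Rightarrow> nat \<Rightarrow> nat \<Rightarrow> real" where
  "diff_y q i j = q $ (2 * i + 1) - q $ (2 * j + 1)"

definition newton_D :: "nat \<Rightarrow> (nat \<Rightarrow> real) \<Rightarrow> real vec \<Rightarrow> real vec \<Rightarrow> real" where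
  "newton_D n m q w = (\<Sum>j<n. \<Sum>i<j. m i * m j *
     (- (diff_x q i j * diff_x w i j + diff_y q i j * diff_y w i j) / body_dist q i j ^ 3))"

definition newton_DD :: "nat \<Rightarrow> (nat \<Rightarrow> real) \<Rightarrow> real vec \<Rightarrow> real vec \<Rightarrow> real vec \<Rightarrow> real" where
  "newton_DD n m q v w = (\<Sum>j<n. \<Sum>i<j. m i * m j *
     (3 * (diff_x q i j * diff_x v i j + diff_y q i j * diff_y v i j)
        * (diff_x q i j * diff_x w i j + diff_y q i j * diff_y w i j) / body_dist q i j ^ 5
      - (diff_x v i j * diff_x w i j + diff_y v i j * diff_y w i j) / body_dist q i j ^ 3))"

lemma DERIV_pair_inverse:
  fixes a b c d :: real
  assumes "sqrt (a\<^sup>2 + b\<^sup>2) \<noteq> 0"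
  shows "((\<lambda>t. 1 / sqrt ((a + t * c)\<^sup>2 + (b + t * d)\<^sup>2)) has_real_derivative
           - (a * c + b * d) / sqrt (a\<^sup>2 + b\<^sup>2) ^ 3) (at 0)"
proof -
  have p: "a\<^sup>2 + b\<^sup>2 > 0" using assms
    by (metis real_sqrt_zero sum_power2_ge_zero order_le_less)
  define R where "R = sqrt (a\<^sup>2 + b\<^sup>2)"
  have R: "R > 0" using p by (simp add: R_def)
  have "((\<lambda>t. 1 / sqrt ((a + t * c)\<^sup>2 + (b + t * d)\<^sup>2)) has_real_derivative
          - ((2 * a * c + 2 * b * d) * (inverse R / 2)) / (R * R)) (at 0)"
    using p R unfolding R_def by (auto intro!: derivative_eq_intros simp: mult_ac)
  also have "- ((2 * a * c + 2 * b * d) * (inverse R / 2)) / (R * R) = - (a * c + b * d) / R ^ 3"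
    using R by (simp add: field_simps eval_nat_numeral)
  finally show ?thesis by (simp add: R_def)
qed

lemma DERIV_pair_inverse2:
  fixes a b c d e f :: real
  assumes "sqrt (a\<^sup>2 + b\<^sup>2) \<noteq> 0"
  shows "((\<lambda>s. - ((a + s * c) * e + (b + s * d) * f) / sqrt ((a + s * c)\<^sup>2 + (b + s * d)\<^sup>2) ^ 3)
           has_real_derivative
           3 * (a * c + b * d) * (a * e + b * f) / sqrt (a\<^sup>2 + b\<^sup>2) ^ 5
             - (c * e + d * f) / sqrt (a\<^sup>2 + b\<^sup>2) ^ 3) (at 0)"
proof -
  define r where "r s = 1 / sqrt ((a + s * c)\<^sup>2 + (b + s * d)\<^sup>2)" for s
  define R where "R = sqrt (a\<^sup>2 + b\<^sup>2)"
  have R: "R \<noteq> 0" using assms by (simp add: R_def)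
  have r0: "r 0 = 1 / R" by (simp add: r_def R_def)
  have "(r has_real_derivative - (a * c + b * d) / R ^ 3) (at 0)"
    unfolding r_def[abs_def] R_def by (rule DERIV_pair_inverse[OF assms])
  then have "((\<lambda>s. - ((a + s * c) * e + (b + s * d) * f) * r s ^ 3) has_real_derivative
      - (c * e + d * f) * r 0 ^ 3
      + - (a * e + b * f) * (3 * r 0 ^ 2 * (- (a * c + b * d) / R ^ 3))) (at 0)"
    by (auto intro!: derivative_eq_intros simp: algebra_simps diff_divide_distrib add_divide_distrib)
  also have "- (c * e + d * f) * r 0 ^ 3
      + - (a * e + b * f) * (3 * r 0 ^ 2 * (- (a * c + b * d) / R ^ 3))
    = 3 * (a * c + b * d) * (a * e + b * f) / R ^ 5 - (c * e + d * f) / R ^ 3"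
    using R unfolding r0 by (simp add: field_simps eval_nat_numeral)
  finally show ?thesis by (simp add: r_def R_def power_divide)
qed

lemma diff_line:
  assumes "q \<in> carrier_vec (2 * n)" "v \<in> carrier_vec (2 * n)" "i < j" "j < n"
  shows "diff_x (q + s \<cdot>\<^sub>v v) i j = diff_x q i j + s * diff_x v i j"
    and "diff_y (q + s \<cdot>\<^sub>v v) i j = diff_y q i j + s * diff_y v i j"
  using assms by (auto simp: diff_x_def diff_y_def algebra_simps)

lemma body_dist_diff: "body_dist q i j = sqrt ((diff_x q i j)\<^sup>2 + (diff_y q i j)\<^sup>2)"
  by (simp add: body_dist_def diff_x_def diff_y_def)

lemma DERIV_newton_U:
  assumes "q \<in> carrier_vec (2 * n)" "w \<in> carrier_vec (2 * n)" "collision_free n q"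
  shows "((\<lambda>t. newton_U n m (q + t \<cdot>\<^sub>v w)) has_real_derivative newton_D n m q w) (at 0)"
proof -
  have "((\<lambda>t. m i * m j / body_dist (q + t \<cdot>\<^sub>v w) i j) has_real_derivative
      m i * m j * (- (diff_x q i j * diff_x w i j + diff_y q i j * diff_y w i j)
        / body_dist q i j ^ 3)) (at 0)" if "j < n" "i < j" for i j
    using DERIV_cmult[OF DERIV_pair_inverse, of "diff_x q i j" "diff_y q i j" "m i * m j"
        "diff_x w i j" "diff_y w i j"] assms that
    by (simp add: body_dist_diff diff_line collision_free_def)
  then show ?thesis
    unfolding newton_U_def newton_D_def by (intro DERIV_sum) auto
qed

lemma DERIV_newton_D:
  assumes "q \<in> carrier_vec (2 * n)" "v \<in> carrier_vec (2 * n)" "collision_free n q"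
  shows "((\<lambda>s. newton_D n m (q + s \<cdot>\<^sub>v v) w) has_real_derivative newton_DD n m q v w) (at 0)"
proof -
  have "((\<lambda>s. m i * m j * (- (diff_x (q + s \<cdot>\<^sub>v v) i j * diff_x w i j
        + diff_y (q + s \<cdot>\<^sub>v v) i j * diff_y w i j) / body_dist (q + s \<cdot>\<^sub>v v) i j ^ 3))
      has_real_derivative m i * m j *
     (3 * (diff_x q i j * diff_x v i j + diff_y q i j * diff_y v i j)
        * (diff_x q i j * diff_x w i j + diff_y q i j * diff_y w i j) / body_dist q i j ^ 5
      - (diff_x v i j * diff_x w i j + diff_y v i j * diff_y w i j) / body_dist q i j ^ 3)) (at 0)"
    if "j < n" "i < j" for i j
    using DERIV_cmult[OF DERIV_pair_inverse2, of "diff_x q i j" "diff_y q i j" "m i * m j"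
        "diff_x v i j" "diff_x w i j" "diff_y v i j" "diff_y w i j"] assms that
    by (simp add: body_dist_diff diff_line collision_free_def)
  then show ?thesis
    unfolding newton_D_def newton_DD_def by (intro DERIV_sum) auto
qed

lemma collision_free_line:
  assumes "q \<in> carrier_vec (2 * n)" "v \<in> carrier_vec (2 * n)" "collision_free n q"
  shows "\<forall>\<^sub>F s in nhds 0. collision_free n (q + s \<cdot>\<^sub>v v)"
proof -
  have "\<forall>\<^sub>F s in nhds 0. body_dist (q + s \<cdot>\<^sub>v v) i j \<noteq> 0" if "j < n" "i < j" for i j
  proof -
    let ?g = "\<lambda>s. sqrt ((diff_x q i j + s * diff_x v i j)\<^sup>2 + (diff_y q i j + s * diff_y v i j)\<^sup>2)"
    have "isCont ?g 0" by (intro continuous_intros)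
    then have "(?g \<longlongrightarrow> ?g 0) (nhds 0)"
      unfolding isCont_def by (rule iffD1[OF tendsto_at_iff_tendsto_nhds, of ?g 0])
    moreover have "?g 0 \<noteq> 0"
      using assms(3) that by (simp add: collision_free_def body_dist_diff)
    ultimately have "\<forall>\<^sub>F s in nhds 0. ?g s \<noteq> 0"
      by (rule tendsto_imp_eventually_ne)
    then show ?thesis using assms that by (simp add: body_dist_diff diff_line)
  qed
  then have "\<forall>\<^sub>F s in nhds 0. \<forall>j\<in>{..<n}. \<forall>i\<in>{..<j}. body_dist (q + s \<cdot>\<^sub>v v) i j \<noteq> 0"
    by (intro eventually_ball_finite ballI) auto
  then show ?thesis unfolding collision_free_def by (rule eventually_mono) blast
qed

lemma mass_inner_sum:
  assumes "u \<in> carrier_vec (2 * n)" "v \<in> carrier_vec (2 * n)"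
  shows "mass_inner n m u v = (\<Sum>i<2 * n. m (i div 2) * u $ i * v $ i)"
proof -
  have "(mass_mat n m *\<^sub>v v) $ i = m (i div 2) * v $ i" if "i < 2 * n" for i
  proof -
    have "(\<Sum>j<2 * n. (if i = j then m (j div 2) else 0) * v $ j)
        = (\<Sum>j<2 * n. if i = j then m (j div 2) * v $ j else 0)"
      by (rule sum.cong) auto
    then show ?thesis
      using assms that
      by (simp add: mass_mat_def mat_diag_def scalar_prod_def atLeast0LessThan)
  qed
  then show ?thesis
    using assms
    by (auto simp: mass_inner_def scalar_prod_def atLeast0LessThan mass_mat_def mat_diag_def
        intro!: sum.cong)
qed

lemma mass_norm_power2:
  assumes "q \<in> carrier_vec (2 * n)" "\<And>i. i < n \<Longrightarrow> m i > 0"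
  shows "(mass_norm n m q)\<^sup>2 = mass_inner n m q q"
proof -
  have "mass_inner n m q q \<ge> 0"
    unfolding mass_inner_sum[OF assms(1,1)] mult.assoc
    by (intro sum_nonneg mult_nonneg_nonneg[OF less_imp_le[OF assms(2)] zero_le_square])
      (auto simp: less_mult_imp_div_less)
  then show ?thesis by (simp add: mass_norm_def)
qed

lemma second_deriv_eff_pot:
  assumes "q \<in> carrier_vec (2 * n)" "v \<in> carrier_vec (2 * n)" "w \<in> carrier_vec (2 * n)"
    and "collision_free n q" "\<And>i. i < n \<Longrightarrow> m i > 0"
  shows "deriv (\<lambda>s. deriv (\<lambda>t. newton_U n m (q + s \<cdot>\<^sub>v v + t \<cdot>\<^sub>v w)) 0) 0 = newton_DD n m q v w"
    and "deriv (\<lambda>s. deriv (\<lambda>t. eff_pot n m q0 (q + s \<cdot>\<^sub>v v + t \<cdot>\<^sub>v w)) 0) 0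
           = - newton_DD n m q v w - (ang_vel n m q0)\<^sup>2 * mass_inner n m v w"
proof -
  let ?k = "ang_vel n m q0"
  have U: "((\<lambda>t. newton_U n m (q + s \<cdot>\<^sub>v v + t \<cdot>\<^sub>v w)) has_real_derivative
      newton_D n m (q + s \<cdot>\<^sub>v v) w) (at 0)" if "collision_free n (q + s \<cdot>\<^sub>v v)" for s
    by (rule DERIV_newton_U[OF _ assms(3) that]) (use assms in simp)
  have M: "((\<lambda>t. (mass_norm n m (p + t \<cdot>\<^sub>v w))\<^sup>2) has_real_derivative
      2 * mass_inner n m p w) (at 0)" if "p \<in> carrier_vec (2 * n)" for p
  proof -
    have "(mass_norm n m (p + t \<cdot>\<^sub>v w))\<^sup>2 =
        (\<Sum>i<2 * n. m (i div 2) * (p $ i + t * w $ i) * (p $ i + t * w $ i))" for t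
      using assms that by (subst mass_norm_power2) (auto simp: mass_inner_sum intro!: sum.cong)
    then show ?thesis
      using assms that
      by (auto simp: mass_inner_sum sum_distrib_left intro!: derivative_eq_intros sum.cong)
  qed
  have M2: "((\<lambda>s. mass_inner n m (q + s \<cdot>\<^sub>v v) w) has_real_derivative mass_inner n m v w) (at 0)"
  proof -
    have "mass_inner n m (q + s \<cdot>\<^sub>v v) w = (\<Sum>i<2 * n. m (i div 2) * (q $ i + s * v $ i) * w $ i)" for s
      using assms by (auto simp: mass_inner_sum intro!: sum.cong)
    then show ?thesis
      using assms by (auto simp: mass_inner_sum intro!: derivative_eq_intros sum.cong)
  qed
  have V: "((\<lambda>t. eff_pot n m q0 (q + s \<cdot>\<^sub>v v + t \<cdot>\<^sub>v w)) has_real_derivative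
      - newton_D n m (q + s \<cdot>\<^sub>v v) w - ?k\<^sup>2 * mass_inner n m (q + s \<cdot>\<^sub>v v) w) (at 0)"
    if "collision_free n (q + s \<cdot>\<^sub>v v)" for s
  proof -
    have "q + s \<cdot>\<^sub>v v \<in> carrier_vec (2 * n)" using assms by simp
    from DERIV_diff[OF DERIV_minus[OF U[OF that]] DERIV_cmult[OF M[OF this], of "?k\<^sup>2 / 2"]]
    show ?thesis unfolding eff_pot_def by simp
  qed
  note ev = collision_free_line[OF assms(1,2,4)]
  have "deriv (\<lambda>s. deriv (\<lambda>t. newton_U n m (q + s \<cdot>\<^sub>v v + t \<cdot>\<^sub>v w)) 0) 0
      = deriv (\<lambda>s. newton_D n m (q + s \<cdot>\<^sub>v v) w) 0"
    by (rule deriv_cong_ev) (use ev in \<open>auto elim!: eventually_mono intro!: DERIV_imp_deriv U\<close>)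
  also have "\<dots> = newton_DD n m q v w"
    by (rule DERIV_imp_deriv[OF DERIV_newton_D[OF assms(1,2,4)]])
  finally show "deriv (\<lambda>s. deriv (\<lambda>t. newton_U n m (q + s \<cdot>\<^sub>v v + t \<cdot>\<^sub>v w)) 0) 0
      = newton_DD n m q v w" .
  have "deriv (\<lambda>s. deriv (\<lambda>t. eff_pot n m q0 (q + s \<cdot>\<^sub>v v + t \<cdot>\<^sub>v w)) 0) 0
      = deriv (\<lambda>s. - newton_D n m (q + s \<cdot>\<^sub>v v) w - ?k\<^sup>2 * mass_inner n m (q + s \<cdot>\<^sub>v v) w) 0"
    by (rule deriv_cong_ev) (use ev in \<open>auto elim!: eventually_mono intro!: DERIV_imp_deriv V\<close>)
  also have "\<dots> = - newton_DD n m q v w - ?k\<^sup>2 * mass_inner n m v w"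
    by (rule DERIV_imp_deriv, rule DERIV_diff[OF DERIV_minus DERIV_cmult])
      (use DERIV_newton_D[OF assms(1,2,4)] M2 in auto)
  finally show "deriv (\<lambda>s. deriv (\<lambda>t. eff_pot n m q0 (q + s \<cdot>\<^sub>v v + t \<cdot>\<^sub>v w)) 0) 0
      = - newton_DD n m q v w - ?k\<^sup>2 * mass_inner n m v w" .
qed

lemma newton_DD_commute: "newton_DD n m q v w = newton_DD n m q w v"
  unfolding newton_DD_def by (intro sum.cong refl) (simp add: algebra_simps)

lemma newton_DD_expand:
  assumes w: "w \<in> carrier_vec (2 * n)"
  shows "newton_DD n m q v w = (\<Sum>l<2 * n. w $ l * newton_DD n m q v (unit_vec (2 * n) l))"
proof -
  have *: "w $ i = (\<Sum>l<2 * n. w $ l * unit_vec (2 * n) l $ i)" if "i < 2 * n" for i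
  proof -
    have "(\<Sum>l<2 * n. w $ l * unit_vec (2 * n) l $ i) = (\<Sum>l<2 * n. if i = l then w $ l else 0)"
      by (rule sum.cong) (use that in auto)
    then show ?thesis using that by simp
  qed
  have d: "diff_x w i j = (\<Sum>l<2 * n. w $ l * diff_x (unit_vec (2 * n) l) i j)"
    "diff_y w i j = (\<Sum>l<2 * n. w $ l * diff_y (unit_vec (2 * n) l) i j)" if "j < n" "i < j" for i j
    unfolding diff_x_def diff_y_def right_diff_distrib sum_subtractf
    using that *[of "2 * i"] *[of "2 * j"] *[of "2 * i + 1"] *[of "2 * j + 1"] by simp_all
  have "newton_DD n m q v w = (\<Sum>j<n. \<Sum>i<j. \<Sum>l<2 * n. w $ l * (m i * m j *
     (3 * (diff_x q i j * diff_x v i j + diff_y q i j * diff_y v i j)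
        * (diff_x q i j * diff_x (unit_vec (2 * n) l) i j + diff_y q i j * diff_y (unit_vec (2 * n) l) i j)
        / body_dist q i j ^ 5
      - (diff_x v i j * diff_x (unit_vec (2 * n) l) i j + diff_y v i j * diff_y (unit_vec (2 * n) l) i j)
        / body_dist q i j ^ 3)))"
    unfolding newton_DD_def
    by (intro sum.cong refl, simp add: d, simp add: algebra_simps add_divide_distrib
        diff_divide_distrib sum.distrib sum_subtractf sum_distrib_left sum_divide_distrib)
  also have "\<dots> = (\<Sum>l<2 * n. \<Sum>j<n. \<Sum>i<j. w $ l * (m i * m j *
     (3 * (diff_x q i j * diff_x v i j + diff_y q i j * diff_y v i j)
        * (diff_x q i j * diff_x (unit_vec (2 * n) l) i j + diff_y q i j * diff_y (unit_vec (2 * n) l) i j)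
        / body_dist q i j ^ 5
      - (diff_x v i j * diff_x (unit_vec (2 * n) l) i j + diff_y v i j * diff_y (unit_vec (2 * n) l) i j)
        / body_dist q i j ^ 3)))"
    by (subst sum.swap[where B = "{..<2 * n}"], rule sum.swap[THEN trans, rotated]) (simp add: sum.swap[where B = "{..<2 * n}"])
  finally show ?thesis by (simp add: newton_DD_def sum_distrib_left)
qed

lemma hessian_newton_U:
  assumes "q \<in> carrier_vec (2 * n)" "collision_free n q" "i < 2 * n" "j < 2 * n"
    and "\<And>i. i < n \<Longrightarrow> m i > 0"
  shows "hessian (newton_U n m) q $$ (i, j)
           = newton_DD n m q (unit_vec (2 * n) i) (unit_vec (2 * n) j)"
  using assms second_deriv_eff_pot(1)[of q n "unit_vec (2 * n) i" "unit_vec (2 * n) j"]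
  by (simp add: hessian_def partial_def carrier_vecD)

lemma hessian_V_red:
  assumes "relative_equilibrium n m q0" "shape_basis n m q0 B" "\<And>i. i < n \<Longrightarrow> m i > 0"
  shows "hessian (V_red n m q0 B) (0\<^sub>v (2 * n - 4)) =
           - (transpose_mat B * hessian (newton_U n m) q0 * B)
             - (ang_vel n m q0)\<^sup>2 \<cdot>\<^sub>m 1\<^sub>m (2 * n - 4)"
proof -
  let ?d = "2 * n - 4"
  have q: "q0 \<in> carrier_vec (2 * n)" "collision_free n q0"
    using assms by (auto simp: relative_equilibrium_def)
  have B: "B \<in> carrier_mat (2 * n) ?d" using assms by (auto simp: shape_basis_def)
  have H: "hessian (newton_U n m) q0 \<in> carrier_mat (2 * n) (2 * n)"
    using q by (simp add: hessian_def carrier_vecD)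
  have lhs: "hessian (V_red n m q0 B) (0\<^sub>v ?d) $$ (i, j)
      = - newton_DD n m q0 (col B i) (col B j) - (ang_vel n m q0)\<^sup>2 * mass_inner n m (col B i) (col B j)"
    if ij: "i < ?d" "j < ?d" for i j
  proof -
    have c: "col B l \<in> carrier_vec (2 * n)" for l using B by (simp add: carrier_vecI)
    have u: "B *\<^sub>v unit_vec ?d l = col B l" if "l < ?d" for l
      using B that by (intro eq_vecI) auto
    have "q0 + B *\<^sub>v (0\<^sub>v ?d + s \<cdot>\<^sub>v unit_vec ?d i + t \<cdot>\<^sub>v unit_vec ?d j)
        = q0 + s \<cdot>\<^sub>v col B i + t \<cdot>\<^sub>v col B j" for s t
      using ij q c
      by (simp add: mult_add_distrib_mat_vec[OF B] mult_mat_vec[OF B] u)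
    then show ?thesis
      using ij second_deriv_eff_pot(2)[OF q(1) c[of i] c[of j] q(2), of m q0] assms(3)
      by (simp add: hessian_def partial_def V_red_def)
  qed
  have rhs: "(transpose_mat B * hessian (newton_U n m) q0 * B) $$ (i, j)
      = newton_DD n m q0 (col B i) (col B j)" if ij: "i < ?d" "j < ?d" for i j
  proof -
    have c: "col B l \<in> carrier_vec (2 * n)" for l using B by (simp add: carrier_vecI)
    have "(transpose_mat B * hessian (newton_U n m) q0 * B) $$ (i, j)
        = (\<Sum>k<2 * n. B $$ (k, i) * (\<Sum>l<2 * n. newton_DD n m q0 (unit_vec (2 * n) k)
             (unit_vec (2 * n) l) * B $$ (l, j)))"
      using ij B H q assms(3)
      by (simp add: scalar_prod_def atLeast0LessThan hessian_newton_U cong: sum.cong_simp)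
    also have "\<dots> = (\<Sum>k<2 * n. col B i $ k * newton_DD n m q0 (unit_vec (2 * n) k) (col B j))"
      by (rule sum.cong, simp, subst newton_DD_expand[OF c])
        (use ij B in \<open>simp add: mult.commute cong: sum.cong_simp\<close>)
    also have "\<dots> = newton_DD n m q0 (col B i) (col B j)"
      unfolding newton_DD_commute[of n m q0 _ "col B j"] by (rule newton_DD_expand[OF c, symmetric])
    finally show ?thesis .
  qed
  show ?thesis
    by (rule eq_matI) (use assms(2) B H lhs rhs in \<open>auto simp: shape_basis_def hessian_def\<close>)
qed

end

theory Submission
  imports Defs
begin

text \<open>
  On the plane of the shape coordinates \<open>(x\<^sub>l, y\<^sub>l)\<close>, with \<open>a = \<alpha> l\<close> and \<open>b = \<beta> l\<close>, the linearized
  equations of motion are \<open>x'' = -2k y' + 2a x\<close> and \<open>y'' = 2k x' + 2b y\<close>. A solution proportional to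
  \<open>exp (\<mu> t)\<close> exists exactly when \<open>\<mu>\<close> is a root of
  \<open>\<chi>(\<mu>) = \<mu>\<^sup>4 + (4k\<^sup>2 - 2a - 2b) \<mu>\<^sup>2 + 4ab\<close>. Put \<open>g = 2 \<surd>a \<surd>b\<close>. If the curvature inequality fails,
  then \<open>\<delta>\<^sup>2 = 2 ((\<surd>a + \<surd>b)\<^sup>2 - 2k\<^sup>2)\<close> has a real solution \<open>\<delta> \<ge> 0\<close>, and the quartic splits as
  \<open>\<chi>(\<mu>) = (\<mu>\<^sup>2 - \<delta>\<mu> + g) (\<mu>\<^sup>2 + \<delta>\<mu> + g)\<close>. The first factor has a root with real part at least
  \<open>\<delta> / 2\<close> (lemma \<open>plane_char_root\<close>). For \<open>\<delta> > 0\<close> this root is an eigenvalue off the imaginary axis.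
  For \<open>\<delta> = 0\<close>, the borderline case, the two factors coincide and the root is a double root of \<open>\<chi>\<close>.

  Both cases use one family of vectors \<open>v(\<mu>)\<close>, polynomial in \<open>\<mu>\<close>, with
  \<open>(A - \<mu>) v(\<mu>) = \<chi>(\<mu>) e\<close> for the Hamiltonian matrix \<open>A\<close> and a fixed vector \<open>e\<close>
  (lemma \<open>hamiltonian_mat_plane_eigvec\<close>). At a root of \<open>\<chi>\<close> the vector \<open>v(\<mu>)\<close> is an eigenvector.
  Differentiating in \<open>\<mu>\<close> gives \<open>(A - \<mu>) v'(\<mu>) = v(\<mu>) + \<chi>'(\<mu>) e\<close>, so at a double root \<open>v'(\<mu>)\<close> is a
  generalized eigenvector above \<open>v(\<mu>)\<close>, which a diagonalizable matrix does not have
  (lemma \<open>diagonalizable_no_generalized_eigenvector\<close>).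
\<close>

section \<open>The matrix generated by a quadratic Hamiltonian\<close>

text \<open>
  Polarization: along a line in direction \<open>e\<^sub>j\<close> the function is a quadratic polynomial whose linear
  coefficient at \<open>q\<close> is \<open>b q e\<^sub>j\<close>, and this is in turn an affine function along \<open>e\<^sub>i\<close> with slope
  \<open>b e\<^sub>i e\<^sub>j\<close>. Linearity is asked only on vectors of dimension \<open>d\<close>, because the components of a sum are
  determined only below the dimension.
\<close>

lemma hessian_quadratic_form:
  fixes b :: "real vec \<Rightarrow> real vec \<Rightarrow> real"
  assumes f: "\<And>v. v \<in> carrier_vec d \<Longrightarrow> f v = b v v / 2"
    and lin: "\<And>u v w t. u \<in> carrier_vec d \<Longrightarrow> v \<in> carrier_vec d \<Longrightarrow> w \<in> carrier_vec d \<Longrightarrow>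
                b (u + t \<cdot>\<^sub>v v) w = b u w + t * b v w"
    and sym: "\<And>u v. b u v = b v u"
    and q: "q \<in> carrier_vec d" and ij: "i < d" "j < d"
  shows "hessian f q $$ (i, j) = b (unit_vec d i) (unit_vec d j)"
proof -
  have first: "partial j f p = b p (unit_vec d j)" if p: "p \<in> carrier_vec d" for p
  proof -
    let ?e = "unit_vec d j"
    have "f (p + t \<cdot>\<^sub>v ?e) = b p p / 2 + t * b p ?e + t\<^sup>2 * b ?e ?e / 2" for t
    proof -
      have "f (p + t \<cdot>\<^sub>v ?e) = (b p (p + t \<cdot>\<^sub>v ?e) + t * b ?e (p + t \<cdot>\<^sub>v ?e)) / 2"
        using p by (simp add: f lin)
      then show ?thesis
        using p by (simp add: sym[of _ "p + t \<cdot>\<^sub>v ?e"] lin sym[of ?e p] field_simps power2_eq_square)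
    qed
    then show ?thesis
      using p unfolding partial_def
      by (auto intro!: DERIV_imp_deriv derivative_eq_intros simp: carrier_vecD)
  qed
  have "partial i (partial j f) q = b (unit_vec d i) (unit_vec d j)"
    unfolding partial_def[of i] using q
    by (auto intro!: DERIV_imp_deriv derivative_eq_intros simp: carrier_vecD first lin)
  then show ?thesis
    using q ij by (simp add: hessian_def carrier_vecD)
qed

text \<open>
  Multiplication by the symplectic matrix moves the momentum rows of the Hessian up and the position
  rows, negated, down.
\<close>

lemma hamiltonian_mat_index:
  assumes i: "i < d" and j: "j < 2 * d"
  shows "hamiltonian_mat d H $$ (i, j)
      = hessian (\<lambda>v. H (vec_first v d) (vec_last v d)) (0\<^sub>v (2 * d)) $$ (d + i, j)"
    and "hamiltonian_mat d H $$ (d + i, j)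
      = - hessian (\<lambda>v. H (vec_first v d) (vec_last v d)) (0\<^sub>v (2 * d)) $$ (i, j)"
proof -
  let ?S = "hessian (\<lambda>v. H (vec_first v d) (vec_last v d)) (0\<^sub>v (2 * d))"
  let ?J = "four_block_mat (0\<^sub>m d d) (1\<^sub>m d) (- 1\<^sub>m d) (0\<^sub>m d d) :: real mat"
  have S: "?S \<in> carrier_mat (2 * d) (2 * d)"
    by (simp add: hessian_def)
  have entry: "hamiltonian_mat d H $$ (r, j) = (\<Sum>s<2 * d. ?J $$ (r, s) * ?S $$ (s, j))"
    if "r < 2 * d" for r
    using S that j unfolding hamiltonian_mat_def
    by (simp add: scalar_prod_def atLeast0LessThan cong: sum.cong_simp)
  have "hamiltonian_mat d H $$ (i, j) = (\<Sum>s<2 * d. if s = d + i then ?S $$ (s, j) else 0)"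
    unfolding entry[OF trans_less_add1[OF i, of d, folded mult_2]]
    using i by (intro sum.cong) auto
  then show "hamiltonian_mat d H $$ (i, j) = ?S $$ (d + i, j)"
    using i by simp
  have "hamiltonian_mat d H $$ (d + i, j) = (\<Sum>s<2 * d. if s = i then - ?S $$ (s, j) else 0)"
    unfolding entry[OF add_strict_left_mono[OF i, of d, folded mult_2]]
    using i by (intro sum.cong) auto
  then show "hamiltonian_mat d H $$ (d + i, j) = - ?S $$ (i, j)"
    using i by simp
qed

lemma hamiltonian_mat_carrier: "hamiltonian_mat d H \<in> carrier_mat (2 * d) (2 * d)"
  unfolding hamiltonian_mat_def carrier_mat_def
  by (simp add: hessian_def mult_2 del: One_nat_def)

section \<open>Jordan chains of diagonalizable matrices\<close>

text \<open>
  In eigencoordinates the chain reads \<open>(d\<^sub>i - l) v\<^sub>i = w\<^sub>i\<close> and \<open>(d\<^sub>i - l) w\<^sub>i = 0\<close> for each \<open>i\<close>.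
  Either \<open>d\<^sub>i = l\<close>, and the first equation gives \<open>w\<^sub>i = 0\<close>, or the second one does.
\<close>

lemma diagonalizable_no_generalized_eigenvector:
  fixes A :: "'a :: field mat"
  assumes sim: "similar_mat A D" and diag: "diagonal_mat D"
    and A: "A \<in> carrier_mat n n" and v: "v \<in> carrier_vec n" and w: "w \<in> carrier_vec n"
    and Av: "A *\<^sub>v v = l \<cdot>\<^sub>v v + w" and Aw: "A *\<^sub>v w = l \<cdot>\<^sub>v w"
  shows "w = 0\<^sub>v n"
proof -
  obtain P Q where "similar_mat_wit A D P Q"
    using sim by (auto simp: similar_mat_def)
  note PQ = similar_mat_witD2[OF A this]
  have "Q * A = Q * (P * (D * Q))"
    unfolding PQ(3) using PQ(5-7) by (subst assoc_mult_mat) auto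
  also have "\<dots> = (Q * P) * (D * Q)"
    using PQ(5-7) by (intro assoc_mult_mat[symmetric]) auto
  finally have "Q * A = D * Q"
    using PQ(2,5,7) by simp
  then have QA: "Q *\<^sub>v (A *\<^sub>v u) = D *\<^sub>v (Q *\<^sub>v u)" if "u \<in> carrier_vec n" for u
    using PQ(5,7) A that by (metis assoc_mult_mat_vec)
  have D: "(D *\<^sub>v u) $ i = D $$ (i, i) * u $ i" if "u \<in> carrier_vec n" "i < n" for u i
  proof -
    have "(D *\<^sub>v u) $ i = (\<Sum>s<n. D $$ (i, s) * u $ s)"
      using PQ(5) that by (simp add: scalar_prod_def atLeast0LessThan cong: sum.cong_simp)
    also have "\<dots> = (\<Sum>s<n. if s = i then D $$ (i, s) * u $ s else 0)"
      using PQ(5) diag that by (intro sum.cong) (auto simp: diagonal_mat_def)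
    finally show ?thesis using that by simp
  qed
  have Q: "Q *\<^sub>v u \<in> carrier_vec n" if "u \<in> carrier_vec n" for u
    using PQ(7) that by (rule mult_mat_vec_carrier)
  have Dv: "D *\<^sub>v (Q *\<^sub>v v) = l \<cdot>\<^sub>v (Q *\<^sub>v v) + Q *\<^sub>v w"
    using v w PQ(7)
    by (simp add: QA[symmetric] Av mult_add_distrib_mat_vec[of _ n n] mult_mat_vec[of _ n n])
  have Dw: "D *\<^sub>v (Q *\<^sub>v w) = l \<cdot>\<^sub>v (Q *\<^sub>v w)"
    using w PQ(7) by (simp add: QA[symmetric] Aw mult_mat_vec[of _ n n])
  have "(Q *\<^sub>v w) $ i = 0" if i: "i < n" for i
  proof -
    have dim: "dim_vec (Q *\<^sub>v v) = n" "dim_vec (Q *\<^sub>v w) = n"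
      using Q[OF v] Q[OF w] by (simp_all only: carrier_vecD)
    have 1: "D $$ (i, i) * (Q *\<^sub>v v) $ i = l * (Q *\<^sub>v v) $ i + (Q *\<^sub>v w) $ i"
      unfolding D[OF Q[OF v] i, symmetric] Dv
      by (simp only: index_add_vec index_smult_vec dim i)
    have 2: "D $$ (i, i) * (Q *\<^sub>v w) $ i = l * (Q *\<^sub>v w) $ i"
      unfolding D[OF Q[OF w] i, symmetric] Dw
      by (simp only: index_smult_vec dim i)
    have cancel: "b = 0" if "c * a = l * a + b" "c * b = l * b" for a b c :: 'a
      using that by (cases "c = l") auto
    show ?thesis by (rule cancel[OF 1 2])
  qed
  then have "Q *\<^sub>v w = 0\<^sub>v n"
    using PQ(7) by (intro eq_vecI) auto
  moreover have "P *\<^sub>v (Q *\<^sub>v w) = w"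
    using PQ(1,6,7) w by (simp flip: assoc_mult_mat_vec[of _ n n _ n])
  moreover have "P *\<^sub>v 0\<^sub>v n = 0\<^sub>v n"
    using PQ(6) by (intro eq_vecI) auto
  ultimately show ?thesis
    by simp
qed

section \<open>Restriction to an invariant plane\<close>

text \<open>
  The polarization of \<open>2 H\<close> for the quadratic Hamiltonian \<open>H\<close> with magnetic term \<open>k\<close> and potential
  \<open>- \<Sum> (\<alpha>\<^sub>i x\<^sub>i\<^sup>2 + \<beta>\<^sub>i y\<^sub>i\<^sup>2)\<close> on \<open>N\<close> planes. Its arguments are the stacked vectors \<open>(z, p)\<close> of
  dimension \<open>4 N\<close>, in which the momentum of the coordinate \<open>j\<close> has the index \<open>2 * N + j\<close>.
\<close>

definition magnetic_form ::
  "nat \<Rightarrow> real \<Rightarrow> (nat \<Rightarrow> real) \<Rightarrow> (nat \<Rightarrow> real) \<Rightarrow> real vec \<Rightarrow> real vec \<Rightarrow> real" where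
  "magnetic_form N k \<alpha> \<beta> u v = (\<Sum>i<N.
      (u $ (2 * N + 2 * i) - k * u $ (2 * i + 1)) * (v $ (2 * N + 2 * i) - k * v $ (2 * i + 1))
    + (u $ (2 * N + 2 * i + 1) + k * u $ (2 * i)) * (v $ (2 * N + 2 * i + 1) + k * v $ (2 * i))
    - 2 * \<alpha> i * u $ (2 * i) * v $ (2 * i) - 2 * \<beta> i * u $ (2 * i + 1) * v $ (2 * i + 1))"

lemma magnetic_form_unit:
  assumes l: "l < N"
  shows "magnetic_form N k \<alpha> \<beta> u (unit_vec (2 * (2 * N)) (2 * l))
      = k * (u $ (2 * N + 2 * l + 1) + k * u $ (2 * l)) - 2 * \<alpha> l * u $ (2 * l)" (is ?x)
    and "magnetic_form N k \<alpha> \<beta> u (unit_vec (2 * (2 * N)) (2 * l + 1))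
      = - k * (u $ (2 * N + 2 * l) - k * u $ (2 * l + 1)) - 2 * \<beta> l * u $ (2 * l + 1)" (is ?y)
    and "magnetic_form N k \<alpha> \<beta> u (unit_vec (2 * (2 * N)) (2 * N + 2 * l))
      = u $ (2 * N + 2 * l) - k * u $ (2 * l + 1)" (is ?a)
    and "magnetic_form N k \<alpha> \<beta> u (unit_vec (2 * (2 * N)) (2 * N + 2 * l + 1))
      = u $ (2 * N + 2 * l + 1) + k * u $ (2 * l)" (is ?b)
proof -
  have pick: "(\<Sum>i<N. f i) = g l" if "\<And>i. i < N \<Longrightarrow> f i = (if i = l then g i else 0)"
    for f g :: "nat \<Rightarrow> real"
    using that l by (simp cong: sum.cong_simp)
  have idx: "unit_vec (2 * (2 * N)) s $ (2 * i) = (if 2 * i = s then 1 else 0)"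
    "unit_vec (2 * (2 * N)) s $ (2 * i + 1) = (if 2 * i + 1 = s then 1 else 0)"
    "unit_vec (2 * (2 * N)) s $ (2 * N + 2 * i) = (if 2 * N + 2 * i = s then 1 else 0)"
    "unit_vec (2 * (2 * N)) s $ (2 * N + 2 * i + 1) = (if 2 * N + 2 * i + 1 = s then 1 else 0)"
    if "i < N" for i s using that by (simp_all add: unit_vec_def)
  have ne: "2 * i + 1 \<noteq> 2 * j" "2 * i \<noteq> 2 * j + 1" "2 * N + 2 * i + 1 \<noteq> 2 * N + 2 * j"
      "2 * N + 2 * i \<noteq> 2 * N + 2 * j + 1" for i j :: nat
    by presburger+
  have ne': "2 * N + 2 * i \<noteq> 2 * j" "2 * N + 2 * i + 1 \<noteq> 2 * j" "2 * N + 2 * i \<noteq> 2 * j + 1"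
      "2 * N + 2 * i + 1 \<noteq> 2 * j + 1" if "j < N" for i j :: nat
    using that by presburger+
  note ne'' = ne'[THEN not_sym]
  show ?x unfolding magnetic_form_def
    by (rule pick[where g = "\<lambda>l. k * (u $ (2 * N + 2 * l + 1) + k * u $ (2 * l))
          - 2 * \<alpha> l * u $ (2 * l)"])
      (use l in \<open>simp only: idx ne ne' ne'', simp\<close>)
  show ?y unfolding magnetic_form_def
    by (rule pick[where g = "\<lambda>l. - k * (u $ (2 * N + 2 * l) - k * u $ (2 * l + 1))
          - 2 * \<beta> l * u $ (2 * l + 1)"])
      (use l in \<open>simp only: idx ne ne' ne'', simp\<close>)
  show ?a unfolding magnetic_form_def
    by (rule pick[where g = "\<lambda>l. u $ (2 * N + 2 * l) - k * u $ (2 * l + 1)"])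
      (use l in \<open>simp only: idx ne ne' ne'', simp\<close>)
  show ?b unfolding magnetic_form_def
    by (rule pick[where g = "\<lambda>l. u $ (2 * N + 2 * l + 1) + k * u $ (2 * l)"])
      (use l in \<open>simp only: idx ne ne' ne'', simp\<close>)
qed

text \<open>
  The position and momentum components of plane \<open>l\<close> are \<open>(x, y)\<close> and \<open>(a, b)\<close>; all others vanish.
  The four indices are distinct, and adding the cases makes the sums over \<open>j\<close> below split.
\<close>

definition plane_vec :: "nat \<Rightarrow> nat \<Rightarrow> complex \<Rightarrow> complex \<Rightarrow> complex \<Rightarrow> complex \<Rightarrow> complex vec" where
  "plane_vec N l x y a b = vec (2 * (2 * N)) (\<lambda>j.
     (if j = 2 * l then x else 0) + (if j = 2 * l + 1 then y else 0)
     + (if j = 2 * N + 2 * l then a else 0) + (if j = 2 * N + 2 * l + 1 then b else 0))"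

text \<open>
  The four components on the right are Hamilton's equations
  \<open>x' = a - k y\<close>, \<open>y' = b + k x\<close>, \<open>a' = 2\<alpha> x - k y'\<close>, \<open>b' = 2\<beta> y + k x'\<close>; no other component
  appears because the form couples each plane only to itself.
\<close>

lemma hamiltonian_mat_plane_vec:
  fixes k :: real and \<alpha> \<beta> :: "nat \<Rightarrow> real" and x y a b :: complex
  assumes l: "l < N"
    and H: "\<And>v. v \<in> carrier_vec (2 * (2 * N)) \<Longrightarrow>
              H (vec_first v (2 * N)) (vec_last v (2 * N)) = magnetic_form N k \<alpha> \<beta> v v / 2"
  shows "map_mat complex_of_real (hamiltonian_mat (2 * N) H) *\<^sub>v plane_vec N l x y a b
      = plane_vec N l (a - k * y) (b + k * x)
          (2 * \<alpha> l * x - k * (b + k * x)) (2 * \<beta> l * y + k * (a - k * y))"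
proof (rule eq_vecI)
  let ?d = "2 * N"
  let ?A = "hamiltonian_mat ?d H"
  let ?e = "unit_vec (2 * ?d) :: nat \<Rightarrow> real vec"
  have S: "hessian (\<lambda>v. H (vec_first v ?d) (vec_last v ?d)) (0\<^sub>v (2 * ?d)) $$ (i, j)
      = magnetic_form N k \<alpha> \<beta> (?e i) (?e j)" if "i < 2 * ?d" "j < 2 * ?d" for i j
    using that
    by (intro hessian_quadratic_form[where d = "2 * ?d"] H)
      (auto simp: magnetic_form_def sum_distrib_left algebra_simps simp flip: sum.distrib
        intro!: sum.cong)
  fix i
  assume "i < dim_vec (plane_vec N l (a - k * y) (b + k * x)
          (2 * \<alpha> l * x - k * (b + k * x)) (2 * \<beta> l * y + k * (a - k * y)))"
  then have i: "i < 2 * ?d" by (simp add: plane_vec_def)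
  have bounds: "2 * l < 2 * ?d" "2 * l + 1 < 2 * ?d" "?d + 2 * l < 2 * ?d" "?d + 2 * l + 1 < 2 * ?d"
    using l by auto
  have "(map_mat complex_of_real ?A *\<^sub>v plane_vec N l x y a b) $ i
      = (\<Sum>j<2 * ?d. complex_of_real (?A $$ (i, j)) * plane_vec N l x y a b $ j)"
    using i hamiltonian_mat_carrier[of ?d H]
    by (simp add: scalar_prod_def atLeast0LessThan plane_vec_def cong: sum.cong_simp)
  also have "\<dots> = (\<Sum>j<2 * ?d. (if j = 2 * l then complex_of_real (?A $$ (i, j)) * x else 0)
      + (if j = 2 * l + 1 then complex_of_real (?A $$ (i, j)) * y else 0)
      + (if j = ?d + 2 * l then complex_of_real (?A $$ (i, j)) * a else 0)
      + (if j = ?d + 2 * l + 1 then complex_of_real (?A $$ (i, j)) * b else 0))"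
    by (intro sum.cong refl) (simp add: plane_vec_def algebra_simps)
  also have "\<dots> = ?A $$ (i, 2 * l) * x + ?A $$ (i, 2 * l + 1) * y
      + ?A $$ (i, ?d + 2 * l) * a + ?A $$ (i, ?d + 2 * l + 1) * b"
    unfolding sum.distrib using bounds by simp
  also have "\<dots> = plane_vec N l (a - k * y) (b + k * x)
          (2 * \<alpha> l * x - k * (b + k * x)) (2 * \<beta> l * y + k * (a - k * y)) $ i"
  proof (cases "i < ?d")
    case True
    have row: "?A $$ (i, j) = magnetic_form N k \<alpha> \<beta> (?e (?d + i)) (?e j)" if "j < 2 * ?d" for j
      by (subst hamiltonian_mat_index(1)[OF True that], subst S) (use True that in auto)
    show ?thesis
      unfolding row[OF bounds(1)] row[OF bounds(2)] row[OF bounds(3)] row[OF bounds(4)]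
        magnetic_form_unit[OF l]
      using True l by (auto simp: plane_vec_def algebra_simps)
  next
    case False
    define r where "r = i - ?d"
    have r: "i = ?d + r" "r < ?d" using False i by (auto simp: r_def)
    have row: "?A $$ (i, j) = - magnetic_form N k \<alpha> \<beta> (?e r) (?e j)" if "j < 2 * ?d" for j
      unfolding r(1) by (subst hamiltonian_mat_index(2)[OF r(2) that], subst S) (use r(2) that in auto)
    show ?thesis
      unfolding row[OF bounds(1)] row[OF bounds(2)] row[OF bounds(3)] row[OF bounds(4)]
        magnetic_form_unit[OF l]
      using r l by (auto simp: plane_vec_def algebra_simps)
  qed
  finally show "(map_mat complex_of_real ?A *\<^sub>v plane_vec N l x y a b) $ i = \<dots>" .
qed (use hamiltonian_mat_carrier[of "2 * N" H] in \<open>simp add: plane_vec_def\<close>)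

lemma plane_vec_linear:
  "c \<cdot>\<^sub>v plane_vec N l x y a b = plane_vec N l (c * x) (c * y) (c * a) (c * b)"
  "plane_vec N l x y a b + plane_vec N l x' y' a' b'
     = plane_vec N l (x + x') (y + y') (a + a') (b + b')"
  by (auto simp: plane_vec_def algebra_simps)

lemma plane_vec_cong:
  "x = x' \<Longrightarrow> y = y' \<Longrightarrow> a = a' \<Longrightarrow> b = b' \<Longrightarrow> plane_vec N l x y a b = plane_vec N l x' y' a' b'"
  by simp

lemma plane_vec_carrier: "plane_vec N l x y a b \<in> carrier_vec (2 * (2 * N))"
  by (simp add: plane_vec_def)

lemma plane_vec_zero: "plane_vec N l 0 0 0 0 = 0\<^sub>v (2 * (2 * N))"
  by (auto simp: plane_vec_def)

section \<open>Eigenvectors and generalized eigenvectors of a plane\<close>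

text \<open>The characteristic polynomial of the block of one plane.\<close>

definition plane_char :: "complex \<Rightarrow> complex \<Rightarrow> complex \<Rightarrow> complex \<Rightarrow> complex" where
  "plane_char k a b \<mu> = \<mu>^4 + (4 * k\<^sup>2 - 2 * a - 2 * b) * \<mu>\<^sup>2 + 4 * a * b"

text \<open>
  The positions \<open>x = 2 k \<mu>\<close> and \<open>y = 2 a - \<mu>\<^sup>2\<close> solve \<open>(\<mu>\<^sup>2 - 2 a) x + 2 k \<mu> y = 0\<close>, which is the first
  equation of motion for \<open>exp (\<mu> t)\<close>; the momenta are then \<open>\<mu> x + k y\<close> and \<open>\<mu> y - k x\<close>, expanded.
  This solves three of the four rows of the eigenvalue equation for every \<open>\<mu>\<close>.
\<close>

definition plane_eigvec :: "nat \<Rightarrow> nat \<Rightarrow> complex \<Rightarrow> complex \<Rightarrow> complex \<Rightarrow> complex vec" where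
  "plane_eigvec N l k a \<mu> = plane_vec N l (2 * k * \<mu>) (2 * a - \<mu>\<^sup>2)
     (k * \<mu>\<^sup>2 + 2 * k * a) (2 * a * \<mu> - \<mu>^3 - 2 * k\<^sup>2 * \<mu>)"

text \<open>The componentwise derivative of \<^const>\<open>plane_eigvec\<close> with respect to \<open>\<mu>\<close>.\<close>

definition plane_eigvec_deriv :: "nat \<Rightarrow> nat \<Rightarrow> complex \<Rightarrow> complex \<Rightarrow> complex \<Rightarrow> complex vec" where
  "plane_eigvec_deriv N l k a \<mu> = plane_vec N l (2 * k) (- 2 * \<mu>)
     (2 * k * \<mu>) (2 * a - 3 * \<mu>\<^sup>2 - 2 * k\<^sup>2)"

text \<open>
  The second identity is the derivative of the first with respect to \<open>\<mu>\<close>; the entry of its last summand is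
  \<open>\<chi>'(\<mu>)\<close> for the polynomial \<open>\<chi>\<close> of the first.
\<close>

lemma hamiltonian_mat_plane_eigvec:
  fixes k :: real and \<alpha> \<beta> :: "nat \<Rightarrow> real" and \<mu> :: complex
  assumes "l < N"
    and "\<And>v. v \<in> carrier_vec (2 * (2 * N)) \<Longrightarrow>
           H (vec_first v (2 * N)) (vec_last v (2 * N)) = magnetic_form N k \<alpha> \<beta> v v / 2"
  defines "A \<equiv> map_mat complex_of_real (hamiltonian_mat (2 * N) H)"
  shows "A *\<^sub>v plane_eigvec N l k (\<alpha> l) \<mu>
      = \<mu> \<cdot>\<^sub>v plane_eigvec N l k (\<alpha> l) \<mu> + plane_vec N l 0 0 0 (plane_char k (\<alpha> l) (\<beta> l) \<mu>)"
    and "A *\<^sub>v plane_eigvec_deriv N l k (\<alpha> l) \<mu>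
      = \<mu> \<cdot>\<^sub>v plane_eigvec_deriv N l k (\<alpha> l) \<mu> + plane_eigvec N l k (\<alpha> l) \<mu>
        + plane_vec N l 0 0 0 (2 * \<mu> * (2 * \<mu>\<^sup>2 + 4 * k\<^sup>2 - 2 * \<alpha> l - 2 * \<beta> l))"
proof -
  have A: "A *\<^sub>v plane_vec N l x y a b
      = plane_vec N l (a - k * y) (b + k * x)
          (2 * \<alpha> l * x - k * (b + k * x)) (2 * \<beta> l * y + k * (a - k * y))" for x y a b :: complex
    unfolding A_def by (rule hamiltonian_mat_plane_vec[OF assms(1,2)])
  show "A *\<^sub>v plane_eigvec N l k (\<alpha> l) \<mu>
      = \<mu> \<cdot>\<^sub>v plane_eigvec N l k (\<alpha> l) \<mu> + plane_vec N l 0 0 0 (plane_char k (\<alpha> l) (\<beta> l) \<mu>)"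
    unfolding plane_eigvec_def plane_char_def
    unfolding A plane_vec_linear
    by (intro plane_vec_cong)
      (simp_all add: algebra_simps power2_eq_square power3_eq_cube power4_eq_xxxx)
  show "A *\<^sub>v plane_eigvec_deriv N l k (\<alpha> l) \<mu>
      = \<mu> \<cdot>\<^sub>v plane_eigvec_deriv N l k (\<alpha> l) \<mu> + plane_eigvec N l k (\<alpha> l) \<mu>
        + plane_vec N l 0 0 0 (2 * \<mu> * (2 * \<mu>\<^sup>2 + 4 * k\<^sup>2 - 2 * \<alpha> l - 2 * \<beta> l))"
    unfolding plane_eigvec_def plane_eigvec_deriv_def
    unfolding A plane_vec_linear
    by (intro plane_vec_cong)
      (simp_all add: algebra_simps power2_eq_square power3_eq_cube)
qed

lemma plane_eigvec_nonzero:
  assumes "l < N" "k \<noteq> 0" "\<mu> \<noteq> 0"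
  shows "plane_eigvec N l k a \<mu> \<noteq> 0\<^sub>v (2 * (2 * N))"
proof
  assume "plane_eigvec N l k a \<mu> = 0\<^sub>v (2 * (2 * N))"
  then have "plane_eigvec N l k a \<mu> $ (2 * l) = 0"
    using assms by simp
  then show False
    using assms by (simp add: plane_eigvec_def plane_vec_def)
qed

section \<open>Failure of the curvature inequality\<close>

text \<open>
  The last property says that a root on the imaginary axis is a double root: the expression is
  \<open>\<chi>'(\<mu>) / (2 \<mu>)\<close>. It holds because the chosen root has real part at least \<open>\<delta> / 2\<close>, so that it can
  be imaginary only when \<open>\<delta> = 0\<close> and the two quadratic factors coincide.
\<close>

lemma plane_char_root:
  fixes k a b :: real
  assumes "k > 0" "a > 0" "b > 0" and fail: "\<not> sqrt a + sqrt b < sqrt 2 * k"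
  obtains \<mu> where "\<mu> \<noteq> 0" "plane_char k a b \<mu> = 0"
    and "Re \<mu> = 0 \<Longrightarrow> 2 * \<mu>\<^sup>2 + 4 * k\<^sup>2 - 2 * a - 2 * b = 0"
proof -
  define g where "g = 2 * sqrt a * sqrt b"
  define \<delta> where "\<delta> = sqrt (2 * ((sqrt a + sqrt b)\<^sup>2 - 2 * k\<^sup>2))"
  \<comment> \<open>the principal square root of the discriminant of \<open>\<mu>\<^sup>2 - \<delta>\<mu> + g\<close>, so that \<open>Re s \<ge> 0\<close>\<close>
  define s where "s = csqrt (of_real (\<delta>\<^sup>2 - 4 * g))"
  define \<mu> where "\<mu> = (of_real \<delta> + s) / 2"
  have "(sqrt 2 * k)\<^sup>2 \<le> (sqrt a + sqrt b)\<^sup>2"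
    using fail \<open>k > 0\<close> by (intro power_mono) auto
  then have rad: "0 \<le> 2 * ((sqrt a + sqrt b)\<^sup>2 - 2 * k\<^sup>2)"
    by (simp add: power_mult_distrib)
  have g: "g > 0" "g\<^sup>2 = 4 * a * b"
    using assms(2,3) by (auto simp: g_def power_mult_distrib)
  have "\<delta>\<^sup>2 = 2 * ((sqrt a + sqrt b)\<^sup>2 - 2 * k\<^sup>2)"
    unfolding \<delta>_def using rad by (rule real_sqrt_pow2)
  then have \<delta>: "4 * k\<^sup>2 - 2 * a - 2 * b = 2 * g - \<delta>\<^sup>2"
    using assms(2,3) by (simp add: g_def power2_sum algebra_simps)
  have "\<delta> \<ge> 0" using rad by (simp add: \<delta>_def)
  have coeff: "4 * (complex_of_real k)\<^sup>2 - 2 * complex_of_real a - 2 * complex_of_real b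
        = 2 * complex_of_real g - (complex_of_real \<delta>)\<^sup>2"
      "4 * complex_of_real a * complex_of_real b = (complex_of_real g)\<^sup>2"
    using arg_cong[OF \<delta>, of complex_of_real] arg_cong[OF g(2), of complex_of_real]
    by simp_all
  have ss: "s * s = complex_of_real \<delta> * complex_of_real \<delta> - 4 * complex_of_real g"
    unfolding s_def power2_eq_square[symmetric] power2_csqrt by simp
  have "4 * (\<mu> * \<mu>) = complex_of_real \<delta> * complex_of_real \<delta> + 2 * complex_of_real \<delta> * s + s * s"
    by (simp add: \<mu>_def field_simps)
  also have "\<dots> = 4 * (complex_of_real \<delta> * \<mu> - complex_of_real g)"
    unfolding ss by (simp add: \<mu>_def field_simps)
  finally have root: "\<mu> * \<mu> = complex_of_real \<delta> * \<mu> - complex_of_real g"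
    by (simp only: mult_cancel_left) simp
  have "plane_char k a b \<mu>
      = (\<mu> * \<mu> - complex_of_real \<delta> * \<mu> + complex_of_real g) * (\<mu> * \<mu> + complex_of_real \<delta> * \<mu> + complex_of_real g)"
    unfolding plane_char_def coeff
    by (simp add: algebra_simps power2_eq_square power4_eq_xxxx)
  then have char: "plane_char k a b \<mu> = 0"
    unfolding root by simp
  have "\<mu> \<noteq> 0" using root g(1) by auto
  have "Re s \<ge> 0"
    unfolding s_def by (rule Re_csqrt)
  then have "\<delta> = 0" if "Re \<mu> = 0"
    using that \<open>\<delta> \<ge> 0\<close> by (simp add: \<mu>_def)
  then have "2 * \<mu>\<^sup>2 + 4 * k\<^sup>2 - 2 * a - 2 * b = 0" if "Re \<mu> = 0"
    using that root coeff(1) by (simp add: power2_eq_square algebra_simps)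
  with \<open>\<mu> \<noteq> 0\<close> char show thesis by (rule that)
qed

text \<open>
  If the inequality failed, the root from the preceding lemma would be an eigenvalue, hence imaginary,
  hence a double root, and the derivative vector would complete a Jordan chain of length two.
\<close>

lemma stable_block_inequality:
  fixes k :: real and \<alpha> \<beta> :: "nat \<Rightarrow> real"
  assumes l: "l < N" and k: "k > 0" and pos: "\<alpha> l > 0" "\<beta> l > 0"
    and H: "\<And>v. v \<in> carrier_vec (2 * (2 * N)) \<Longrightarrow>
              H (vec_first v (2 * N)) (vec_last v (2 * N)) = magnetic_form N k \<alpha> \<beta> v v / 2"
    and imag: "\<And>\<mu>. \<mu> \<in> spectrum (map_mat complex_of_real (hamiltonian_mat (2 * N) H)) \<Longrightarrow> Re \<mu> = 0"
    and diag: "diagonalizable_complex (hamiltonian_mat (2 * N) H)"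
  shows "sqrt (\<alpha> l) + sqrt (\<beta> l) < sqrt 2 * k"
proof (rule ccontr)
  let ?A = "map_mat complex_of_real (hamiltonian_mat (2 * N) H)"
  note A = hamiltonian_mat_plane_eigvec[where H = H, OF l H]
  assume "\<not> sqrt (\<alpha> l) + sqrt (\<beta> l) < sqrt 2 * k"
  then obtain \<mu> where \<mu>: "\<mu> \<noteq> 0" "plane_char k (\<alpha> l) (\<beta> l) \<mu> = 0"
    "Re \<mu> = 0 \<Longrightarrow> 2 * \<mu>\<^sup>2 + 4 * k\<^sup>2 - 2 * \<alpha> l - 2 * \<beta> l = 0"
    using plane_char_root k pos by metis
  define v where "v = plane_eigvec N l k (\<alpha> l) \<mu>"
  define w where "w = plane_eigvec_deriv N l k (\<alpha> l) \<mu>"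
  have A_carrier: "?A \<in> carrier_mat (2 * (2 * N)) (2 * (2 * N))"
    using hamiltonian_mat_carrier[of "2 * N" H] by simp
  have carrier: "v \<in> carrier_vec (2 * (2 * N))" "w \<in> carrier_vec (2 * (2 * N))"
    unfolding v_def w_def plane_eigvec_def plane_eigvec_deriv_def by (rule plane_vec_carrier)+
  have "v \<noteq> 0\<^sub>v (2 * (2 * N))"
    unfolding v_def using l k \<mu>(1) by (intro plane_eigvec_nonzero) auto
  have eig: "?A *\<^sub>v v = \<mu> \<cdot>\<^sub>v v"
    using A(1)[of \<mu>] \<mu>(2) carrier(1) by (simp add: plane_vec_zero flip: v_def)
  have "eigenvector ?A v \<mu>"
    unfolding eigenvector_def
    using eig carrier(1) \<open>v \<noteq> _\<close> A_carrier by simp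
  then have "Re \<mu> = 0"
    by (intro imag) (auto simp: spectrum_def eigenvalue_def)
  then have gen: "?A *\<^sub>v w = \<mu> \<cdot>\<^sub>v w + v"
    using A(2)[of \<mu>] \<mu>(3) carrier by (simp add: plane_vec_zero flip: v_def w_def)
  obtain D where "diagonal_mat D" "similar_mat ?A D"
    using diag by (auto simp: diagonalizable_complex_def)
  then have "v = 0\<^sub>v (2 * (2 * N))"
    using diagonalizable_no_generalized_eigenvector[OF _ _ A_carrier carrier(2,1) gen eig] by blast
  with \<open>v \<noteq> _\<close> show False ..
qed

section \<open>Relative equilibria\<close>

text \<open>
  Positivity of the angular velocity enters twice: to square the failed inequality, and because the
  position \<open>x = 2 k \<mu>\<close> of the eigenvector must not vanish. The pair of bodies 0 and 1 alone
  already makes the Newtonian sum positive.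
\<close>

lemma ang_vel_pos:
  assumes "n \<ge> 2" "\<And>i. i < n \<Longrightarrow> m i > 0" "collision_free n q0"
  shows "ang_vel n m q0 > 0"
proof -
  have pair: "m i * m j / body_dist q0 i j > 0" if "j < n" "i < j" for i j
  proof -
    have "body_dist q0 i j > 0"
      using assms(3) that unfolding collision_free_def
      by (metis body_dist_def order_le_less real_sqrt_ge_zero sum_power2_ge_zero)
    then show ?thesis using assms(2) that by simp
  qed
  have "newton_U n m q0 > 0"
    unfolding newton_U_def
    using assms(1) pair[of 1 0]
    by (intro sum_pos2[where i = 1 and I = "{..<n}"])
      (auto intro!: sum_nonneg order_less_imp_le[OF pair])
  then show ?thesis by (simp add: ang_vel_def)
qed

theorem proposition5p2:
  fixes n :: nat and m :: "nat \<Rightarrow> real" and q0 :: "real vec" and B :: "real mat"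
    and \<alpha> \<beta> :: "nat \<Rightarrow> real"
  assumes "n \<ge> 3"
    and "\<And>i. i < n \<Longrightarrow> m i > 0"
    and "relative_equilibrium n m q0"
    and "shape_basis n m q0 B"
    and "\<And>z. z \<in> carrier_vec (2 * n - 4) \<Longrightarrow>
           V_lin n m q0 B z =
             (\<Sum>i < n - 2. - \<alpha> i * (z $ (2 * i))\<^sup>2 - \<beta> i * (z $ (2 * i + 1))\<^sup>2)"
    and "\<exists>i < n - 2. \<alpha> i > 0 \<and> \<beta> i > 0 \<and>
           \<not> sqrt (\<alpha> i) + sqrt (\<beta> i) < sqrt 2 * ang_vel n m q0"
  shows "linearly_unstable n m q0 B"
proof -
  define N where "N = n - 2"
  define k where "k = ang_vel n m q0"
  have d: "2 * n - 4 = 2 * N" by (simp add: N_def)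
  have k: "k > 0"
    using ang_vel_pos[of n m q0] assms(1-3) by (simp add: k_def relative_equilibrium_def)
  have H: "H_lin n m q0 B (vec_first v (2 * N)) (vec_last v (2 * N)) = magnetic_form N k \<alpha> \<beta> v v / 2"
    if v: "v \<in> carrier_vec (2 * (2 * N))" for v
  proof -
    let ?z = "vec_first v (2 * N)" and ?p = "vec_last v (2 * N)"
    have idx: "?z $ (2 * i) = v $ (2 * i)" "?z $ (2 * i + 1) = v $ (2 * i + 1)"
      "?p $ (2 * i) = v $ (2 * N + 2 * i)" "?p $ (2 * i + 1) = v $ (2 * N + 2 * i + 1)"
      if "i < N" for i
      using v that by (auto simp: vec_first_def vec_last_def carrier_vecD)
    have "V_lin n m q0 B ?z = (\<Sum>i<N. - \<alpha> i * (?z $ (2 * i))\<^sup>2 - \<beta> i * (?z $ (2 * i + 1))\<^sup>2)"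
      unfolding N_def by (rule assms(5)) (simp add: d N_def)
    then have "H_lin n m q0 B ?z ?p
        = (\<Sum>i<N. ((?p $ (2 * i) - k * ?z $ (2 * i + 1))\<^sup>2 + (?p $ (2 * i + 1) + k * ?z $ (2 * i))\<^sup>2) / 2
            + (- \<alpha> i * (?z $ (2 * i))\<^sup>2 - \<beta> i * (?z $ (2 * i + 1))\<^sup>2))"
      unfolding H_lin_def Let_def k_def[symmetric] N_def[symmetric] sum.distrib[where A = "{..<N}"]
        sum_divide_distrib[symmetric]
      by (simp only: sum.distrib)
    also have "\<dots> = magnetic_form N k \<alpha> \<beta> v v / 2"
      unfolding magnetic_form_def sum_divide_distrib
    proof (rule sum.cong[OF refl])
      fix i assume "i \<in> {..<N}"
      then have i: "i < N" by simp
      show "((?p $ (2 * i) - k * ?z $ (2 * i + 1))\<^sup>2 + (?p $ (2 * i + 1) + k * ?z $ (2 * i))\<^sup>2) / 2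
            + (- \<alpha> i * (?z $ (2 * i))\<^sup>2 - \<beta> i * (?z $ (2 * i + 1))\<^sup>2)
          = ((v $ (2 * N + 2 * i) - k * v $ (2 * i + 1)) * (v $ (2 * N + 2 * i) - k * v $ (2 * i + 1))
            + (v $ (2 * N + 2 * i + 1) + k * v $ (2 * i)) * (v $ (2 * N + 2 * i + 1) + k * v $ (2 * i))
            - 2 * \<alpha> i * v $ (2 * i) * v $ (2 * i) - 2 * \<beta> i * v $ (2 * i + 1) * v $ (2 * i + 1)) / 2"
        unfolding idx[OF i] power2_eq_square
        by (simp add: add_divide_distrib diff_divide_distrib)
    qed
    finally show ?thesis .
  qed
  obtain l where l: "l < N" "\<alpha> l > 0" "\<beta> l > 0" "\<not> sqrt (\<alpha> l) + sqrt (\<beta> l) < sqrt 2 * k"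
    using assms(6) by (auto simp: N_def k_def)
  show ?thesis
    unfolding linearly_unstable_def linearly_stable_def Let_def d
    using stable_block_inequality[where H = "H_lin n m q0 B", OF l(1) k l(2,3) H] l(4) by blast
qed

end
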